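(* Let $n \ge 1$ and let $G \le S_n$ be a subgroup. Suppose $H \le G$ is a subgroup such that $P(H)$ is a face of $P(G)$. Then there is a partition $[n] = \bigsqcup_k I_k$ such that $H = \operatorname{stab}(G; (I_k)_k)$.
   Context: Here $[n] := \{1, \ldots, n\}$. The symmetric group $S_n$ of permutations of $[n]$ is identified with the group of $n \times n$ permutation matrices: a permutation $g$ corresponds to the matrix in $\mathbb{R}^{n \times n}$ whose $(i,j)$-entry is $1$ if $g(j) = i$ and $0$ otherwise. For a subgroup $G \le S_n$, the permutation polytope $P(G)$ is the convex hull in $\mathbb{R}^{n \times n}$ of the permutation matrices of the elements of $G$. A face of a polytope is meant in the usual sense of convex geometry (the polytope itself counts as a face). For a partition $[n] = \bigsqcup_k I_k$ of the ground set, the stabilizer of the partition in $G$ is the subgroup $$\operatorname{stab}(G; (I_k)_k) := \{ \sigma \in G : \sigma(I_k) = I_k \text{ for all } k \} \le G,$$ i.e. each part is mapped to itself as a set. *)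

theory Defs
  imports "HOL-Analysis.Analysis" "HOL-Library.Disjoint_Sets" "HOL-Algebra.Bij"
begin

text \<open>The ground set \<open>[n]\<close> is a finite type \<open>'n\<close> with \<open>n = CARD('n)\<close>, so that the
  symmetric group is \<open>BijGroup UNIV\<close>, whose multiplication is composition of functions.\<close>

abbreviation Sym :: "('n::finite \<Rightarrow> 'n) monoid" where
  "Sym \<equiv> BijGroup UNIV"

definition perm_matrix :: "('n::finite \<Rightarrow> 'n) \<Rightarrow> real ^ 'n ^ 'n" where
  "perm_matrix g = (\<chi> i j. if g j = i then 1 else 0)"

definition perm_polytope :: "('n::finite \<Rightarrow> 'n) set \<Rightarrow> (real ^ 'n ^ 'n) set" where
  "perm_polytope G = convex hull (perm_matrix ` G)"

definition partition_stab :: "('n \<Rightarrow> 'n) set \<Rightarrow> 'n set set \<Rightarrow> ('n \<Rightarrow> 'n) set" where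
  "partition_stab G P = {\<sigma> \<in> G. \<forall>I\<in>P. \<sigma> ` I = I}"

end

theory Submission
  imports Defs
begin

text \<open>The partition is the one into orbits of \<open>H\<close>. Elements of \<open>H\<close> preserve their own
  orbits, so the content lies in the converse: a \<open>\<sigma> \<in> G\<close> that maps every \<open>H\<close>-orbit to itself
  lies in \<open>H\<close>. For such a \<open>\<sigma>\<close>, the coset \<open>H \<circ> \<sigma>\<close> and \<open>H\<close> have the same barycentre: each
  column \<open>j\<close> has \<open>\<sigma> j = k j\<close> for some \<open>k \<in> H\<close>, possibly varying with \<open>j\<close>, and
  right translation by \<open>k\<close> permutes \<open>H\<close> (lemma \<open>sum_perm_matrix_coset\<close>). Thus the barycentre of
  the points of \<open>H \<circ> \<sigma>\<close>, all of which lie in \<open>P(G)\<close>, is a point of the face \<open>P(H)\<close>. An average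
  of points of a polytope lies in a face only if all of them do, so the matrix of \<open>\<sigma>\<close>, which is
  one of these points, lies in \<open>P(H)\<close> (lemma \<open>face_of_polytope_sum\<close>). A permutation matrix lies in the convex hull of a
  set of permutation matrices only if it belongs to that set (lemma
  \<open>perm_matrix_in_perm_polytope_iff\<close>), whence \<open>\<sigma> \<in> H\<close>.\<close>

lemma mem_Sym_iff: "g \<in> carrier Sym \<longleftrightarrow> bij g"
  by (simp add: BijGroup_def Bij_def)

lemma mult_Sym: "bij g \<Longrightarrow> bij h \<Longrightarrow> g \<otimes>\<^bsub>Sym\<^esub> h = g \<circ> h"
  by (simp add: BijGroup_def Bij_def compose_def fun_eq_iff)

lemma
  fixes H :: "('n::finite \<Rightarrow> 'n) set"
  assumes "subgroup H Sym"
  shows subgroup_Sym_bij: "h \<in> H \<Longrightarrow> bij h"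
    and subgroup_Sym_id: "id \<in> H"
    and subgroup_Sym_comp: "g \<in> H \<Longrightarrow> h \<in> H \<Longrightarrow> g \<circ> h \<in> H"
    and subgroup_Sym_inv: "h \<in> H \<Longrightarrow> inv_into UNIV h \<in> H"
proof -
  interpret subgroup H Sym by fact
  show bij: "bij h" if "h \<in> H" for h
    using that mem_carrier mem_Sym_iff by blast
  have "\<one>\<^bsub>Sym\<^esub> = (id :: 'n \<Rightarrow> 'n)"
    by (simp add: BijGroup_def fun_eq_iff)
  then show "id \<in> H"
    using one_closed by simp
  show "g \<circ> h \<in> H" if "g \<in> H" "h \<in> H"
    using m_closed[OF that] mult_Sym bij that by metis
  show "inv_into UNIV h \<in> H" if "h \<in> H"
  proof -
    have "inv\<^bsub>Sym\<^esub> h = inv_into UNIV h"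
      using inv_BijGroup[of h UNIV] bij[OF that] by (simp add: Bij_def fun_eq_iff)
    then show ?thesis
      using m_inv_closed[OF that] by simp
  qed
qed

lemma inner_perm_matrix:
  "perm_matrix g \<bullet> perm_matrix h = real (card {j. g j = h j})"
proof -
  have "perm_matrix g \<bullet> perm_matrix h
      = (\<Sum>i\<in>UNIV. \<Sum>j\<in>UNIV. if g j = i then (if h j = i then 1 else 0) else 0)"
    unfolding inner_vec_def perm_matrix_def
    by (intro sum.cong refl) auto
  also have "\<dots> = (\<Sum>j\<in>UNIV. if h j = g j then 1 else 0)"
    by (subst sum.swap) simp
  also have "\<dots> = real (card {j. g j = h j})"
    by (simp add: sum.If_cases eq_commute)
  finally show ?thesis .
qed

text \<open>The linear functional given by the inner product with the matrix of \<open>g\<close> counts agreements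
  with \<open>g\<close>. Among all permutation matrices it is maximal at \<open>g\<close> only, so it separates \<open>g\<close>
  from the hull of any others.\<close>

lemma perm_matrix_in_perm_polytope_iff:
  "perm_matrix g \<in> perm_polytope H \<longleftrightarrow> g \<in> H"
proof
  assume "perm_matrix g \<in> perm_polytope H"
  show "g \<in> H"
  proof (rule ccontr)
    assume "g \<notin> H"
    have "perm_matrix g \<bullet> perm_matrix h < perm_matrix g \<bullet> perm_matrix g" if "h \<in> H" for h
    proof -
      have "g \<noteq> h"
        using that \<open>g \<notin> H\<close> by blast
      then have "{j. g j = h j} \<subset> UNIV"
        by (auto simp: fun_eq_iff)
      then have "card {j. g j = h j} < CARD('a)"
        by (simp add: psubset_card_mono)
      then show ?thesis
        by (simp add: inner_perm_matrix)
    qed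
    then have "perm_matrix ` H \<subseteq> {X. perm_matrix g \<bullet> X < perm_matrix g \<bullet> perm_matrix g}"
      by auto
    then have "perm_polytope H \<subseteq> {X. perm_matrix g \<bullet> X < perm_matrix g \<bullet> perm_matrix g}"
      unfolding perm_polytope_def by (rule hull_minimal) (rule convex_halfspace_lt)
    with \<open>perm_matrix g \<in> perm_polytope H\<close> show False
      by auto
  qed
qed (simp add: perm_polytope_def hull_inc)

lemma polytope_perm_polytope: "polytope (perm_polytope G)"
  unfolding perm_polytope_def polytope_def by (intro exI[of _ "perm_matrix ` G"]) simp

text \<open>Every face of a polytope is cut out by a supporting hyperplane. The functional attains
  its maximum over the polytope on average over the \<open>x i\<close>, hence at every one of them.\<close>

lemma face_of_polytope_sum:
  fixes S T :: "'a::euclidean_space set"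
  assumes "polytope S" "T face_of S" "finite A"
    and S: "\<And>i. i \<in> A \<Longrightarrow> x i \<in> S"
    and T: "\<And>i. i \<in> A \<Longrightarrow> y i \<in> T"
    and eq: "(\<Sum>i\<in>A. x i) = (\<Sum>i\<in>A. y i)"
    and "j \<in> A"
  shows "x j \<in> T"
proof -
  obtain a b where ab: "S \<subseteq> {x. a \<bullet> x \<le> b}" "T = S \<inter> {x. a \<bullet> x = b}"
    using assms(1,2) exposed_face_of_polyhedron[of S T] polytope_imp_polyhedron
    by (auto simp: exposed_face_of_def)
  have "(\<Sum>i\<in>A. b - a \<bullet> x i) = (\<Sum>i\<in>A. b - a \<bullet> y i)"
    by (simp add: sum_subtractf inner_sum_right[symmetric] eq)
  also have "\<dots> = 0"
    using T ab(2) by (intro sum.neutral) auto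
  finally have "\<forall>i\<in>A. b - a \<bullet> x i = 0"
    using S ab(1) \<open>finite A\<close> by (subst (asm) sum_nonneg_eq_0_iff) auto
  with \<open>j \<in> A\<close> S show ?thesis
    using ab(2) by auto
qed

text \<open>The identity is checked one column at a time, because the element of \<open>H\<close> that agrees with
  \<open>\<sigma>\<close> at \<open>j\<close> depends on \<open>j\<close>.\<close>

lemma sum_perm_matrix_coset:
  assumes H: "subgroup H Sym" and \<sigma>: "\<And>j. \<exists>k\<in>H. k j = \<sigma> j"
  shows "(\<Sum>h\<in>H. perm_matrix (h \<circ> \<sigma>)) = (\<Sum>h\<in>H. perm_matrix h)"
proof -
  have "(\<Sum>h\<in>H. perm_matrix (h \<circ> \<sigma>)) $ i $ j = (\<Sum>h\<in>H. perm_matrix h) $ i $ j" for i j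
  proof -
    obtain k where k: "k \<in> H" "k j = \<sigma> j"
      using \<sigma> by blast
    have "bij k"
      using subgroup_Sym_bij[OF H k(1)] .
    then have "bij_betw (\<lambda>h. h \<circ> k) H H"
      using k(1) subgroup_Sym_comp[OF H] subgroup_Sym_inv[OF H]
      by (intro bij_betw_byWitness[where f' = "\<lambda>h. h \<circ> inv_into UNIV k"])
        (auto simp: o_assoc[symmetric] bij_is_inj surj_iff[THEN iffD1, OF bij_is_surj])
    then have "(\<Sum>h\<in>H. perm_matrix h $ i $ j) = (\<Sum>h\<in>H. perm_matrix (h \<circ> k) $ i $ j)"
      by (rule sum.reindex_bij_betw[symmetric])
    also have "\<dots> = (\<Sum>h\<in>H. perm_matrix (h \<circ> \<sigma>) $ i $ j)"
      by (simp add: perm_matrix_def k(2))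
    finally show ?thesis
      by (simp add: sum_component)
  qed
  then show ?thesis
    by (simp add: vec_eq_iff)
qed

definition orbit_rel :: "('n \<Rightarrow> 'n) set \<Rightarrow> 'n rel" where
  "orbit_rel H = {(i, j). \<exists>h\<in>H. h i = j}"

lemma equiv_orbit_rel:
  assumes H: "subgroup H Sym"
  shows "equiv UNIV (orbit_rel H)"
proof (rule equivI)
  show "refl (orbit_rel H)"
    using subgroup_Sym_id[OF H] by (auto simp: orbit_rel_def refl_on_def intro!: bexI[of _ id])
  show "sym (orbit_rel H)"
  proof (rule symI)
    fix i j assume "(i, j) \<in> orbit_rel H"
    then obtain h where "h \<in> H" "h i = j"
      by (auto simp: orbit_rel_def)
    then have "inv_into UNIV h \<in> H" "inv_into UNIV h j = i"
      using subgroup_Sym_inv[OF H] subgroup_Sym_bij[OF H] by (auto simp: bij_is_inj)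
    then show "(j, i) \<in> orbit_rel H"
      by (auto simp: orbit_rel_def)
  qed
  show "trans (orbit_rel H)"
  proof (rule transI)
    fix i j l assume "(i, j) \<in> orbit_rel H" "(j, l) \<in> orbit_rel H"
    then obtain g h where "g \<in> H" "g j = l" "h \<in> H" "h i = j"
      by (auto simp: orbit_rel_def)
    then show "(i, l) \<in> orbit_rel H"
      using subgroup_Sym_comp[OF H, of g h]
      by (auto simp: orbit_rel_def intro!: bexI[of _ "g \<circ> h"])
  qed
qed auto

lemma subgroup_preserves_orbit:
  assumes H: "subgroup H Sym" and "h \<in> H"
  shows "h ` (orbit_rel H `` {i}) = orbit_rel H `` {i}"
proof -
  have sub: "h ` (orbit_rel H `` {i}) \<subseteq> orbit_rel H `` {i}"
  proof clarsimp
    fix j assume "(i, j) \<in> orbit_rel H"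
    then obtain k where "k \<in> H" "k i = j"
      by (auto simp: orbit_rel_def)
    then show "(i, h j) \<in> orbit_rel H"
      using subgroup_Sym_comp[OF H \<open>h \<in> H\<close>, of k]
      by (auto simp: orbit_rel_def intro!: bexI[of _ "h \<circ> k"])
  qed
  have "inj h"
    using subgroup_Sym_bij[OF assms] by (rule bij_is_inj)
  then have "card (h ` (orbit_rel H `` {i})) = card (orbit_rel H `` {i})"
    by (simp add: card_image inj_on_subset)
  with sub show ?thesis
    by (simp add: card_subset_eq)
qed

theorem theorem4:
  fixes G H :: "('n::finite \<Rightarrow> 'n) set"
  assumes "subgroup G Sym"
    and "subgroup H (Sym\<lparr>carrier := G\<rparr>)"
    and "perm_polytope H face_of perm_polytope G"
  shows "\<exists>P. partition_on UNIV P \<and> H = partition_stab G P"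
proof (intro exI conjI)
  have H: "subgroup H Sym"
    using group.incl_subgroup[OF group_BijGroup assms(1,2)] .
  have "H \<subseteq> G"
    using subgroup.subset[OF assms(2)] by simp
  let ?P = "UNIV // orbit_rel H"
  show "partition_on UNIV ?P"
    using equiv_orbit_rel[OF H] by (rule partition_on_quotient)
  show "H = partition_stab G ?P"
  proof
    show "H \<subseteq> partition_stab G ?P"
      using \<open>H \<subseteq> G\<close> subgroup_preserves_orbit[OF H]
      unfolding partition_stab_def quotient_def by blast
    show "partition_stab G ?P \<subseteq> H"
    proof
      fix \<sigma> assume "\<sigma> \<in> partition_stab G ?P"
      then have "\<sigma> \<in> G" and stab: "\<sigma> ` (orbit_rel H `` {j}) = orbit_rel H `` {j}" for j
        by (auto simp: partition_stab_def quotientI)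
      have "\<exists>k\<in>H. k j = \<sigma> j" for j
      proof -
        have "j \<in> orbit_rel H `` {j}"
          using equiv_orbit_rel[OF H] by (rule equiv_class_self) simp
        then have "\<sigma> j \<in> orbit_rel H `` {j}"
          using stab by blast
        then show ?thesis
          by (simp add: orbit_rel_def)
      qed
      then have sum_eq: "(\<Sum>h\<in>H. perm_matrix (h \<circ> \<sigma>)) = (\<Sum>h\<in>H. perm_matrix h)"
        by (rule sum_perm_matrix_coset[OF H])
      have "perm_matrix (id \<circ> \<sigma>) \<in> perm_polytope H"
      proof (rule face_of_polytope_sum[OF polytope_perm_polytope assms(3) _ _ _ sum_eq])
        show "perm_matrix (h \<circ> \<sigma>) \<in> perm_polytope G" if "h \<in> H" for h
          using that \<open>\<sigma> \<in> G\<close> \<open>H \<subseteq> G\<close> subgroup_Sym_comp[OF assms(1)]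
          by (auto simp: perm_matrix_in_perm_polytope_iff)
      qed (simp_all add: perm_matrix_in_perm_polytope_iff subgroup_Sym_id[OF H])
      then show "\<sigma> \<in> H"
        by (simp add: perm_matrix_in_perm_polytope_iff)
    qed
  qed
qed

end
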